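(* Let $p$ be an odd prime, and let $B$ be a mixed zero-sum sequence of $n\ge 3$ nonzero vectors in $\mathbb F_p^2$. Then $$|\Omega(B)|=|\mathcal W(B)|\ge \min(p,n-1).$$
   Context: A sequence over $V=\mathbb F_p^2$ is a finite unordered list of vectors, with repetitions allowed (a finite multiset); its length counts multiplicity. It is zero-sum if the sum of all its terms is $0$. It is collinear if all its terms lie on a one-dimensional linear subspace of $V$, and mixed otherwise. Write a vector as $u=(a(u),b(u))$ and let $\omega(u,v)=a(u)b(v)-a(v)b(u)$. For an ordering $I=(u_1,\dots,u_n)$ of a sequence put $q(I)=\sum_{i<j}a(u_i)b(u_j)\in\mathbb F_p$ and $W(I)=\sum_{i<j}\omega(u_i,u_j)\in\mathbb F_p$. For a sequence $B$, $\Omega(B)=\{q(I): I \text{ is an ordering of } B\}$ and $\mathcal W(B)=\{W(I): I\text{ is an ordering of }B\}$, both subsets of $\mathbb F_p$. *)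

theory Defs
  imports
    "HOL-Analysis.Analysis"
    "HOL-Combinatorics.Multiset_Permutations"
    "Berlekamp_Zassenhaus.Finite_Field"
begin

text \<open>
  The prime field of order \<open>p\<close> is the type \<open>'p mod_ring\<close> with \<open>'p\<close> of class \<open>prime_card\<close>,
  so that \<open>p = CARD('p)\<close>, and the plane over it is \<open>'p mod_ring ^ 2\<close>.
  Sequences in the sense of the paper (unordered, with repetitions) are finite multisets.
\<close>

type_synonym 'p plane = "'p mod_ring ^ 2"

definition zero_sum :: "'p::prime_card plane multiset \<Rightarrow> bool" where
  "zero_sum B \<longleftrightarrow> sum_mset B = 0"

definition collinear_seq :: "'p::prime_card plane multiset \<Rightarrow> bool" where
  "collinear_seq B \<longleftrightarrow> (\<exists>L. vec.subspace L \<and> vec.dim L = 1 \<and> set_mset B \<subseteq> L)"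

definition mixed :: "'p::prime_card plane multiset \<Rightarrow> bool" where
  "mixed B \<longleftrightarrow> \<not> collinear_seq B"

definition omega :: "'p::prime_card plane \<Rightarrow> 'p plane \<Rightarrow> 'p mod_ring" where
  "omega u v = u $ 1 * v $ 2 - v $ 1 * u $ 2"

definition q :: "'p::prime_card plane list \<Rightarrow> 'p mod_ring" where
  "q I = (\<Sum>j<length I. \<Sum>i<j. (I ! i) $ 1 * (I ! j) $ 2)"

definition W :: "'p::prime_card plane list \<Rightarrow> 'p mod_ring" where
  "W I = (\<Sum>j<length I. \<Sum>i<j. omega (I ! i) (I ! j))"

definition Omega_set :: "'p::prime_card plane multiset \<Rightarrow> 'p mod_ring set" where
  "Omega_set B = q ` permutations_of_multiset B"

definition W_set :: "'p::prime_card plane multiset \<Rightarrow> 'p mod_ring set" where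
  "W_set B = W ` permutations_of_multiset B"

end

theory Submission
  imports Defs
begin

text \<open>
  For an ordering \<open>I\<close> of a zero-sum sequence \<open>B\<close>, expanding \<open>(\<Sum>a(u)) * (\<Sum>b(u)) = 0\<close> gives
  \<open>W I = 2 * q I + c\<close>, where \<open>c = \<Sum>a(u) * b(u)\<close> depends on \<open>B\<close> only (\<open>W_eq_two_q\<close>).
  As \<open>2\<close> is invertible, the two value sets correspond under an affine bijection, and it remains
  to bound the number of values of \<open>W\<close>.

  The bound is proved by induction on the length, merging two terms at a time. Suppose
  \<open>omega u v \<noteq> 0\<close> and let \<open>B'\<close> arise from \<open>B\<close> by replacing \<open>u, v\<close> with the single term
  \<open>u + v\<close>. In any ordering of \<open>B'\<close> the term \<open>u + v\<close> can be split again into \<open>u, v\<close> or into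
  \<open>v, u\<close>, which changes \<open>W\<close> by \<open>omega u v\<close> or \<open>- omega u v\<close> respectively (\<open>W_set_merge\<close>).
  So the values for \<open>B\<close> include two translates of the set of values for \<open>B'\<close>, by amounts that
  differ because \<open>p\<close> is odd. The union of translates of a nonempty set \<open>S\<close> by two different amounts
  is larger than \<open>S\<close>, unless \<open>S\<close> is the whole
  field: otherwise \<open>S\<close> would be invariant under a nonzero translation, and such a translation
  generates the additive group of the prime field (\<open>card_two_translates\<close>, the Cauchy--Davenport
  inequality for a summand with two elements). Each merge thus gains one value
  until the whole field is reached.

  What makes the induction work is that, as long as at least four terms are present, the merge can
  be chosen so that the shorter sequence again spans the plane (\<open>exists_merge\<close>). If merging
  \<open>u, v\<close> puts all terms on the line through \<open>u + v\<close>, then \<open>u\<close> and \<open>v\<close> are the only terms of \<open>B\<close> off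
  this line, and merging \<open>u\<close> with a term of the line leaves \<open>v\<close> together with another term of
  the line. After \<open>n - 3\<close> such merges, one more merge of three terms starts the count at two
  values, giving \<open>n - 1\<close> in total or the whole field.
\<close>

section \<open>The two statistics of an ordering\<close>

lemma pair_sum_Cons:
  fixes f :: "'a \<Rightarrow> 'a \<Rightarrow> 'b::comm_monoid_add"
  shows "(\<Sum>j<length (x # xs). \<Sum>i<j. f ((x # xs) ! i) ((x # xs) ! j))
    = (\<Sum>j<length xs. f x (xs ! j)) + (\<Sum>j<length xs. \<Sum>i<j. f (xs ! i) (xs ! j))"
  by (simp only: list.size add_Suc_right add_0_right sum.lessThan_Suc_shift)
     (simp add: sum.lessThan_Suc_shift sum.distrib)

lemma omega_add_left: "omega (u + v) w = omega u w + omega v w"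
  and omega_add_right: "omega u (v + w) = omega u v + omega u w"
  and omega_zero_right [simp]: "omega u 0 = 0"
  and omega_self [simp]: "omega u u = 0"
  by (simp_all add: omega_def algebra_simps)

lemma omega_commute: "omega v u = - omega u v"
  by (simp add: omega_def)

lemma q_Nil [simp]: "q [] = 0" and W_Nil [simp]: "W [] = 0"
  by (simp_all add: q_def W_def)

lemma q_Cons: "q (x # xs) = x $ 1 * sum_list xs $ 2 + q xs"
proof -
  have "(\<Sum>j<length xs. x $ 1 * (xs ! j) $ 2) = x $ 1 * sum_list xs $ 2"
    by (induction xs rule: rev_induct) (simp_all add: nth_append algebra_simps)
  thus ?thesis
    unfolding q_def by (subst pair_sum_Cons[of "\<lambda>u v. u $ 1 * v $ 2"]) simp
qed

lemma W_Cons: "W (x # xs) = omega x (sum_list xs) + W xs"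
proof -
  have "(\<Sum>j<length xs. omega x (xs ! j)) = omega x (sum_list xs)"
    by (induction xs rule: rev_induct) (simp_all add: nth_append omega_add_right)
  thus ?thesis
    unfolding W_def by (subst pair_sum_Cons[of omega]) simp
qed

lemma W_append: "W (xs @ ys) = W xs + W ys + omega (sum_list xs) (sum_list ys)"
  by (induction xs) (simp_all add: W_Cons omega_add_left omega_add_right omega_commute[of 0])

text \<open>
  With \<open>q'\<close> the value of \<open>q\<close> on the reversed list, \<open>W = q - q'\<close>, while \<open>q + q'\<close> together with
  the diagonal terms \<open>a(u) * b(u)\<close> is the product of the two coordinate sums. Eliminate \<open>q'\<close>.
\<close>

lemma W_eq_two_q:
  "W xs = 2 * q xs + (\<Sum>u\<leftarrow>xs. u $ 1 * u $ 2) - sum_list xs $ 1 * sum_list xs $ 2"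
  by (induction xs) (simp_all add: W_Cons q_Cons omega_def algebra_simps)

lemma two_neq_zero_mod_ring:
  assumes "odd CARD('p)"
  shows "(2 :: 'p::prime_card mod_ring) \<noteq> 0"
proof
  assume "(2 :: 'p mod_ring) = 0"
  hence "of_nat 2 = (0 :: 'p mod_ring)" by simp
  hence "CARD('p) dvd 2"
    using of_nat_0_mod_ring_dvd by blast
  hence "CARD('p) = 2"
    using primes_dvd_imp_eq[OF prime_card[where 'a='p] two_is_prime_nat] by simp
  thus False using assms by simp
qed

lemma W_set_conv_Omega_set:
  assumes "zero_sum B"
  shows "W_set B = (\<lambda>t. 2 * t + (\<Sum>u\<in>#B. u $ 1 * u $ 2)) ` Omega_set B"
proof -
  have "W I = 2 * q I + (\<Sum>u\<in>#B. u $ 1 * u $ 2)" if "I \<in> permutations_of_multiset B" for I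
  proof -
    have "mset I = B" using that by (simp add: permutations_of_multiset_def)
    moreover have "sum_list I = 0"
      using assms \<open>mset I = B\<close> by (metis sum_mset_sum_list zero_sum_def)
    ultimately show ?thesis
      by (auto simp: W_eq_two_q simp flip: sum_mset_sum_list)
  qed
  thus ?thesis by (simp add: W_set_def Omega_set_def image_image)
qed

section \<open>Merging two terms and the gain of one value\<close>

text \<open>
  All terms other than \<open>u\<close> and \<open>v\<close> see the adjacent block \<open>u, v\<close> only through its sum \<open>u + v\<close>,
  since \<open>omega\<close> is bilinear; the interaction inside the block is what remains.
\<close>

lemma W_set_merge:
  assumes "t \<in> W_set (add_mset (u + v) R)"
  shows "t + omega u v \<in> W_set (add_mset u (add_mset v R))"
proof -
  obtain I where I: "mset I = add_mset (u + v) R" "t = W I"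
    using assms by (auto simp: W_set_def permutations_of_multiset_def)
  then obtain xs ys where "I = xs @ (u + v) # ys"
    using split_list[of "u + v" I] by (auto simp flip: set_mset_mset)
  moreover from this I have "mset (xs @ u # v # ys) = add_mset u (add_mset v R)" by simp
  ultimately show ?thesis
    unfolding W_set_def permutations_of_multiset_def using I(2)
    by (intro image_eqI[where x = "xs @ u # v # ys"])
       (simp_all add: W_append W_Cons omega_add_left omega_add_right)
qed

text \<open>
  In a field of prime order every element is a natural multiple of a given \<open>d \<noteq> 0\<close>, so the
  translates of \<open>s\<close> by multiples of \<open>d\<close> already exhaust the field.
\<close>

lemma invariant_translate_eq_UNIV:
  fixes S :: "'p::prime_card mod_ring set"
  assumes "s \<in> S" and "d \<noteq> 0" and "\<And>x. x \<in> S \<Longrightarrow> x + d \<in> S"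
  shows "S = UNIV"
proof -
  have multiples: "s + of_nat k * d \<in> S" for k
  proof (induction k)
    case (Suc k)
    thus ?case using assms(3)[of "s + of_nat k * d"] by (simp add: algebra_simps)
  qed (simp add: assms(1))
  have "x \<in> S" for x
  proof -
    obtain k where "(x - s) / d = of_nat k"
      using surj_of_nat_mod_ring by blast
    thus ?thesis using multiples[of k] assms(2) by (simp add: field_simps)
  qed
  thus ?thesis by blast
qed

text \<open>
  If the two translates had a union no larger than \<open>S\<close>, they would coincide, which makes \<open>S\<close>
  invariant under translation by \<open>2 * d\<close>. Oddness of the characteristic ensures \<open>2 * d \<noteq> 0\<close>.
\<close>

lemma card_two_translates:
  fixes S :: "'p::prime_card mod_ring set"
  assumes "odd CARD('p)" and "d \<noteq> 0" and "S \<noteq> {}"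
  shows "card ((\<lambda>x. x + d) ` S \<union> (\<lambda>x. x - d) ` S) \<ge> min CARD('p) (card S + 1)"
proof (rule ccontr)
  let ?P = "(\<lambda>x. x + d) ` S" and ?M = "(\<lambda>x. x - d) ` S"
  assume less: "\<not> ?thesis"
  have card: "card ?P = card S" "card ?M = card S"
    by (auto intro!: card_image inj_onI)
  have "card (?P \<union> ?M) \<le> card S" using less by simp
  hence "?P = ?P \<union> ?M" "?M = ?P \<union> ?M"
    using card by (intro card_seteq; simp)+
  hence "?P = ?M" by simp
  have "x + 2 * d \<in> S" if "x \<in> S" for x
  proof -
    from that \<open>?P = ?M\<close> have "x + d \<in> ?M" by blast
    thus ?thesis by (auto simp: algebra_simps)
  qed
  moreover obtain s where "s \<in> S" using \<open>S \<noteq> {}\<close> by blast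
  ultimately have "S = UNIV"
    using invariant_translate_eq_UNIV[of s S "2 * d"] two_neq_zero_mod_ring[OF assms(1)] assms(2)
    by simp
  hence "card ?P = CARD('p mod_ring)" using card by simp
  moreover have "card ?P \<le> card (?P \<union> ?M)" by (intro card_mono) auto
  ultimately show False using less by simp
qed

lemma card_W_set_merge:
  fixes R :: "'p::prime_card plane multiset"
  assumes "odd CARD('p)" and "omega u v \<noteq> 0"
  shows "card (W_set (add_mset u (add_mset v R)))
    \<ge> min CARD('p) (card (W_set (add_mset (u + v) R)) + 1)"
proof -
  let ?S = "W_set (add_mset (u + v) R)" and ?T = "W_set (add_mset u (add_mset v R))"
  have "?S \<noteq> {}" by (simp add: W_set_def)
  moreover have "(\<lambda>x. x + omega u v) ` ?S \<union> (\<lambda>x. x - omega u v) ` ?S \<subseteq> ?T"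
    using W_set_merge[of _ u v R] W_set_merge[of _ v u R]
    by (auto simp: omega_commute[of v u] add.commute add_mset_commute)
  hence "card ((\<lambda>x. x + omega u v) ` ?S \<union> (\<lambda>x. x - omega u v) ` ?S) \<le> card ?T"
    by (intro card_mono) auto
  ultimately show ?thesis
    using card_two_translates[OF assms, of ?S] by linarith
qed

section \<open>Collinearity\<close>

text \<open>
  Cramer's rule for the coordinates of \<open>r\<close> with respect to \<open>w\<close> and \<open>u\<close>, with denominators cleared.
\<close>

lemma omega_expansion: "omega w u *s r = omega r u *s w + omega w r *s u"
  by (simp add: vec_eq_iff forall_2 omega_def algebra_simps)

lemma parallel_omega_neq_zero:
  assumes "omega w r = 0" and "r \<noteq> 0" and "omega w u \<noteq> 0"
  shows "omega u r \<noteq> 0"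
proof
  assume "omega u r = 0"
  hence "omega w u *s r = 0"
    using omega_expansion[of w u r] assms(1) by (simp add: omega_commute[of r u])
  thus False using assms by simp
qed

text \<open>
  The induction works with the algebraic form of noncollinearity, the existence of two terms with
  \<open>omega \<noteq> 0\<close>. It follows from the definition by subspaces because the vectors \<open>v\<close> with
  \<open>omega u v = 0\<close> form the line spanned by \<open>u\<close>.
\<close>

lemma mixed_imp_omega_neq_zero:
  assumes "mixed B" and "u \<in># B" and "u \<noteq> 0"
  shows "\<exists>v. v \<in># B \<and> omega u v \<noteq> 0"
proof (rule ccontr)
  assume "\<not> ?thesis"
  hence parallel: "omega u v = 0" if "v \<in># B" for v using that by blast
  obtain e where e: "omega u e \<noteq> 0"
  proof (cases "u $ 1 = 0")
    case True
    hence "u $ 2 \<noteq> 0" using \<open>u \<noteq> 0\<close> by (simp add: vec_eq_iff forall_2)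
    thus ?thesis using that[of "axis 1 1"] by (simp add: omega_def axis_def)
  next
    case False
    thus ?thesis using that[of "axis 2 1"] by (simp add: omega_def axis_def)
  qed
  have "v \<in> vec.span {u}" if "v \<in># B" for v
  proof -
    have "omega u e *s v = omega v e *s u"
      using omega_expansion[of u e v] parallel[OF that] by simp
    hence "v = (omega v e / omega u e) *s u"
      using e by (simp add: vec_eq_iff field_simps)
    thus ?thesis by (metis vec.span_base vec.span_scale singletonI)
  qed
  moreover have "vec.dim (vec.span {u}) = 1"
    using \<open>u \<noteq> 0\<close> by (simp add: vec.dim_eq_card_independent)
  ultimately have "collinear_seq B"
    unfolding collinear_seq_def by (intro exI[of _ "vec.span {u}"]) auto
  thus False using assms(1) by (simp add: mixed_def)
qed

section \<open>The lower bound\<close>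

text \<open>
  The induction needs a merge that keeps the sequence noncollinear. The pair \<open>u, v\<close>
  itself is a suitable choice unless all other terms lie on the line through \<open>u + v\<close>. In that case
  pick two of these terms, \<open>l\<close> and \<open>r\<close>, which is where four terms are required. Neither \<open>u\<close>
  nor \<open>v\<close> lies on the line, so \<open>u, l\<close> can be merged, and \<open>v, r\<close> survive as a noncollinear pair.
\<close>

lemma exists_merge:
  fixes B :: "'p::prime_card plane multiset"
  assumes "size B \<ge> 4" and "\<forall>u\<in>#B. u \<noteq> 0"
    and "u \<in># B" and "v \<in># B" and "omega u v \<noteq> 0"
  obtains x y R where "B = add_mset x (add_mset y R)" "omega x y \<noteq> 0"
    "\<exists>r s. r \<in># add_mset (x + y) R \<and> s \<in># add_mset (x + y) R \<and> omega r s \<noteq> 0"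
proof -
  have "u \<noteq> v" using assms(5) by auto
  then obtain R where B: "B = add_mset u (add_mset v R)"
    using assms(3,4) by (metis insert_DiffM insert_noteq_member)
  show ?thesis
  proof (cases "\<exists>r. r \<in># R \<and> omega (u + v) r \<noteq> 0")
    case True
    thus ?thesis using that[OF B assms(5)] by fastforce
  next
    case False
    obtain l r R' where R: "R = add_mset l (add_mset r R')"
    proof -
      have "size R = Suc (Suc (size R - 2))" using assms(1) B by simp
      thus ?thesis using that by (metis size_eq_Suc_imp_eq_union add_mset_add_single size_add_mset nat.inject)
    qed
    have "omega (u + v) u \<noteq> 0" "omega (u + v) v \<noteq> 0"
      using assms(5) by (simp_all add: omega_add_left omega_commute[of v u])
    moreover have "omega (u + v) l = 0" "omega (u + v) r = 0" "l \<noteq> 0" "r \<noteq> 0"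
      using False R B assms(2) by auto
    ultimately have "omega u l \<noteq> 0" "omega v r \<noteq> 0"
      using parallel_omega_neq_zero by blast+
    moreover have "B = add_mset u (add_mset l (add_mset v (add_mset r R')))"
      using B R by (simp add: add_mset_commute)
    ultimately show ?thesis using that[of u l "add_mset v (add_mset r R')"] by fastforce
  qed
qed

lemma card_W_set_ge:
  fixes B :: "'p::prime_card plane multiset"
  assumes "odd CARD('p)" and "size B \<ge> 3" and "\<forall>u\<in>#B. u \<noteq> 0"
    and "u \<in># B" and "v \<in># B" and "omega u v \<noteq> 0"
  shows "card (W_set B) \<ge> min CARD('p) (size B - 1)"
proof -
  obtain k where "size B = k + 3"
    using assms(2) by (metis le_add_diff_inverse2)
  thus ?thesis
    using assms(3-)
  proof (induction k arbitrary: B u v)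
    case 0
    \<comment> \<open>The merged sequence has two terms and hence at least one value of \<open>W\<close>; the merge adds another.\<close>
    have "u \<noteq> v" using "0.prems" by auto
    then obtain R where B: "B = add_mset u (add_mset v R)"
      using "0.prems" by (metis insert_DiffM insert_noteq_member)
    have "card (W_set (add_mset (u + v) R)) > 0"
      by (simp add: W_set_def card_gt_0_iff)
    hence "min CARD('p) 2 \<le> card (W_set B)"
      using card_W_set_merge[OF assms(1) "0.prems"(5), of R] unfolding B by linarith
    thus ?case using "0.prems"(1) by simp
  next
    case (Suc k)
    have "size B \<ge> 4" using Suc.prems(1) by simp
    obtain x y R where B: "B = add_mset x (add_mset y R)" and xy: "omega x y \<noteq> 0"
      and "\<exists>r s. r \<in># add_mset (x + y) R \<and> s \<in># add_mset (x + y) R \<and> omega r s \<noteq> 0"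
      using exists_merge[OF \<open>size B \<ge> 4\<close> Suc.prems(2-5)] by blast
    then obtain r s where rs: "r \<in># add_mset (x + y) R" "s \<in># add_mset (x + y) R" "omega r s \<noteq> 0"
      by blast
    let ?B' = "add_mset (x + y) R"
    have "x + y \<noteq> 0"
    proof
      assume "x + y = 0"
      hence "omega x (x + y) = 0" by simp
      thus False using xy by (simp add: omega_add_right)
    qed
    hence "\<forall>r\<in>#?B'. r \<noteq> 0" using Suc.prems(2) B by auto
    moreover have "size ?B' = k + 3" using Suc.prems(1) B by simp
    ultimately have "min CARD('p) (k + 2) \<le> card (W_set ?B')"
      using Suc.IH[of ?B' r s] rs by simp
    moreover have "min CARD('p) (card (W_set ?B') + 1) \<le> card (W_set B)"
      using card_W_set_merge[OF assms(1) xy] B by simp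
    ultimately show ?case using Suc.prems(1) by linarith
  qed
qed

theorem theorem3p2:
  fixes B :: "'p::prime_card plane multiset" and n :: nat
  assumes "odd CARD('p)"
    and "size B = n" and "n \<ge> 3"
    and "\<forall>u\<in>#B. u \<noteq> 0"
    and "zero_sum B"
    and "mixed B"
  shows "card (Omega_set B) = card (W_set B) \<and> card (W_set B) \<ge> min CARD('p) (n - 1)"
proof
  have "inj (\<lambda>t :: 'p mod_ring. 2 * t + c)" for c
    using two_neq_zero_mod_ring[OF assms(1)] by (intro injI) simp
  thus "card (Omega_set B) = card (W_set B)"
    unfolding W_set_conv_Omega_set[OF assms(5)]
    by (simp add: card_image inj_on_subset[OF _ subset_UNIV])
  obtain u where u: "u \<in># B"
    using assms(2,3) by (metis multiset_nonemptyE not_numeral_le_zero size_empty)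
  then obtain v where "v \<in># B" "omega u v \<noteq> 0"
    using mixed_imp_omega_neq_zero[OF assms(6)] assms(4) by blast
  thus "card (W_set B) \<ge> min CARD('p) (n - 1)"
    using card_W_set_ge[OF assms(1)] assms(2-4) u by blast
qed

end
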